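(* For every partition $\lambda$ and every polynomial $p\in\mathbb{C}[x]$, we have $H_\lambda^2\,p\in\mathcal{U}_\lambda$, where $\mathcal{U}_\lambda=\operatorname{span}\{H_{\lambda,i} : i\in\mathbb{N}_0\setminus K_\lambda\}$.
   Context: $\mathbb{N}_0$ denotes the non-negative integers. A partition $\lambda$ of length $\ell$ is a sequence of integers $\lambda_1\ge\lambda_2\ge\cdots\ge\lambda_\ell>0$ with $\lambda_i=0$ for $i>\ell$. Put $k_i=\lambda_i+\ell-i$ for $i=1,\dots,\ell$ and $K_\lambda=\{k_1,\dots,k_\ell\}$ (so $k_1>\cdots>k_\ell>0$). Let $H_n(x)=(-1)^n e^{x^2}\left(\frac{d}{dx}\right)^n e^{-x^2}$, $n\in\mathbb{N}_0$, be the classical Hermite polynomials. With $\operatorname{Wr}[f_1,\dots,f_n]=\det\big(f_j^{(i-1)}\big)_{i,j=1}^n$ the Wronskian determinant (equal to $1$ for the empty list), define the polynomials $$H_\lambda=\operatorname{Wr}[H_{k_\ell},\dots,H_{k_1}],\qquad H_{\lambda,i}=\operatorname{Wr}[H_{k_\ell},\dots,H_{k_1},H_i],\quad i\in\mathbb{N}_0\setminus K_\lambda.$$ The span is taken over $\mathbb{C}$, as a subspace of $\mathbb{C}[x]$. *)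

theory Defs
  imports "HOL-Analysis.Derivative" "Jordan_Normal_Form.Determinant"
begin

text \<open>The classical Hermite polynomials as elements of \<open>\<complex>[x]\<close>, given by the Rodrigues formula.
  The derivative is the complex one. The two lemmas following the definition show
  that the described polynomial exists, so that the formula does determine it.\<close>

definition hermite :: "nat \<Rightarrow> complex poly" where
  "hermite n = (THE h. \<forall>x. poly h x =
     (-1) ^ n * exp (x^2) * (deriv ^^ n) (\<lambda>t. exp (- (t^2))) x)"

lemma Rodrigues_polynomial_exists:
  "\<exists>h. \<forall>x::complex. poly h x =
     (-1) ^ n * exp (x^2) * (deriv ^^ n) (\<lambda>t. exp (- (t^2))) x"
proof (induction n)
  case 0
  have "\<forall>x::complex. poly 1 x = (-1) ^ 0 * exp (x^2) * (deriv ^^ 0) (\<lambda>t. exp (- (t^2))) x"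
    by (simp flip: exp_add)
  then show ?case by blast
next
  case (Suc n)
  then obtain h :: "complex poly" where h: "poly h x =
     (-1) ^ n * exp (x^2) * (deriv ^^ n) (\<lambda>t. exp (- (t^2))) x" for x
    by blast
  have sq: "((-1::complex) ^ n) * (-1) ^ n = 1"
    by (simp flip: power_mult_distrib)
  have e: "exp (- (x^2)) * exp (x^2) = 1" for x :: complex
    by (simp flip: exp_add)
  have D: "(deriv ^^ n) (\<lambda>t. exp (- (t^2))) = (\<lambda>x. (-1) ^ n * exp (- (x^2)) * poly h x)"
  proof
    fix x :: complex
    have "(-1) ^ n * exp (- (x^2)) * poly h x =
      ((-1) ^ n * (-1) ^ n) * (exp (- (x^2)) * exp (x^2)) * (deriv ^^ n) (\<lambda>t. exp (- (t^2))) x"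
      by (simp add: h)
    then show "(deriv ^^ n) (\<lambda>t. exp (- (t^2))) x = (-1) ^ n * exp (- (x^2)) * poly h x"
      by (simp add: sq e)
  qed
  have "deriv (\<lambda>x. (-1) ^ n * exp (- (x^2)) * poly h x) x =
      (-1) ^ n * exp (- (x^2)) * (poly (pderiv h) x - 2 * x * poly h x)" for x :: complex
    by (rule DERIV_imp_deriv)
      (auto intro!: derivative_eq_intros poly_DERIV simp: algebra_simps)
  then have "(deriv ^^ Suc n) (\<lambda>t. exp (- (t^2))) x =
      (-1) ^ n * exp (- (x^2)) * (poly (pderiv h) x - 2 * x * poly h x)" for x :: complex
    by (simp add: D)
  then have "(-1) ^ Suc n * exp (x^2) * (deriv ^^ Suc n) (\<lambda>t. exp (- (t^2))) x =
      - ((-1) ^ n * (-1) ^ n) * (exp (- (x^2)) * exp (x^2)) *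
        (poly (pderiv h) x - 2 * x * poly h x)" for x :: complex
    by (simp only: power_Suc) (simp only: ac_simps mult_minus_left mult_minus_right mult_1_left)
  then have "\<forall>x. poly ([:0, 2:] * h - pderiv h) x =
      (-1) ^ Suc n * exp (x^2) * (deriv ^^ Suc n) (\<lambda>t. exp (- (t^2))) x"
    by (simp only: sq e) simp
  then show ?case by blast
qed

lemma poly_hermite:
  "poly (hermite n) x = (-1) ^ n * exp (x^2) * (deriv ^^ n) (\<lambda>t. exp (- (t^2))) x"
proof -
  obtain h :: "complex poly" where h: "\<forall>x. poly h x =
     (-1) ^ n * exp (x^2) * (deriv ^^ n) (\<lambda>t. exp (- (t^2))) x"
    using Rodrigues_polynomial_exists by blast
  have "\<forall>x. poly (hermite n) x =
     (-1) ^ n * exp (x^2) * (deriv ^^ n) (\<lambda>t. exp (- (t^2))) x"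
    unfolding hermite_def
    by (rule theI, rule h) (metis h poly_eq_poly_eq_iff ext)
  then show ?thesis by blast
qed

definition wronskian :: "complex poly list \<Rightarrow> complex poly" where
  "wronskian fs = det (mat (length fs) (length fs) (\<lambda>(i, j). (pderiv ^^ i) (fs ! j)))"

text \<open>A partition is represented by the list of its positive parts \<open>\<lambda>\<^sub>1, \<dots>, \<lambda>\<^sub>\<ell>\<close>;
  the empty list is the partition of length 0.\<close>

definition is_partition :: "nat list \<Rightarrow> bool" where
  "is_partition l \<longleftrightarrow> sorted_wrt (\<ge>) l \<and> (\<forall>a\<in>set l. a > 0)"

text \<open>The list \<open>[k\<^sub>1, \<dots>, k\<^sub>\<ell>]\<close>. List positions start at 0, so position \<open>i\<close>
  holds \<open>k\<^bsub>i+1\<^esub>\<close>; the subtraction does not truncate, since \<open>i < length l\<close>.\<close>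

definition partition_ks :: "nat list \<Rightarrow> nat list" where
  "partition_ks l = map (\<lambda>i. l ! i + length l - Suc i) [0..<length l]"

definition K_part :: "nat list \<Rightarrow> nat set" where
  "K_part l = set (partition_ks l)"

definition H_part :: "nat list \<Rightarrow> complex poly" where
  "H_part l = wronskian (map hermite (rev (partition_ks l)))"

definition H_part_ext :: "nat list \<Rightarrow> nat \<Rightarrow> complex poly" where
  "H_part_ext l i = wronskian (map hermite (rev (partition_ks l)) @ [hermite i])"

text \<open>\<open>module.span smult\<close> is the \<open>\<complex>\<close>-linear span in \<open>\<complex>[x]\<close>.\<close>

lemma vector_space_smult_complex: "vector_space (smult :: complex \<Rightarrow> complex poly \<Rightarrow> complex poly)"
  by unfold_locales (simp_all add: smult_add_left smult_add_right)

definition U_part :: "nat list \<Rightarrow> complex poly set" where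
  "U_part l = module.span smult (H_part_ext l ` (- K_part l))"

end

theory Submission
  imports Defs
begin

text \<open>
  Fix polynomials \<open>f\<^sub>1, \<dots>, f\<^sub>n\<close> with Wronskian \<open>\<eta>\<close> and consider the linear operator
  \<open>W f = Wr[f\<^sub>1, \<dots>, f\<^sub>n, f]\<close>. It kills every \<open>f\<^sub>j\<close>, and the Hermite polynomials span
  \<open>\<complex>[x]\<close>; so for the Hermite polynomials indexed by \<open>K\<^sub>\<lambda>\<close> the space \<open>\<U>\<^sub>\<lambda>\<close> is
  the full image \<open>W(\<complex>[x])\<close>. It remains to solve \<open>W f = \<eta>\<^sup>2 p\<close> in polynomials,
  and this is possible for arbitrary \<open>f\<^sub>1, \<dots>, f\<^sub>n\<close>.

  The equation is a linear differential equation for \<open>f\<close> whose homogeneous solutions include the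
  \<open>f\<^sub>j\<close>, and variation of parameters solves it: \<open>f = \<Sum>\<^sub>j c\<^sub>j f\<^sub>j\<close> with
  \<open>c\<^sub>j' = u\<^sub>j p\<close>, where the \<open>u\<^sub>j\<close> are the cofactors of the last row of the Wronskian
  matrix. In general variation of parameters divides by \<open>\<eta>\<close>, so that the \<open>c\<^sub>j'\<close> are only
  rational functions; the factor \<open>\<eta>\<^sup>2\<close> on the right-hand side is exactly what makes them
  polynomials, and a polynomial has a polynomial antiderivative.
\<close>

section \<open>The Wronskian as a function of its last entry\<close>

definition last_column_cofactor :: "complex poly list \<Rightarrow> nat \<Rightarrow> complex poly" where
  "last_column_cofactor fs i =
     cofactor (mat (Suc (length fs)) (Suc (length fs)) (\<lambda>(i, j). (pderiv ^^ i) ((fs @ [0]) ! j)))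
       i (length fs)"

text \<open>The cofactors do not see the last column, so they are the same for all \<open>f\<close>. This
  exhibits \<open>f \<mapsto> Wr[f\<^sub>1, \<dots>, f\<^sub>n, f]\<close> as a linear differential operator.\<close>

lemma wronskian_snoc:
  "wronskian (fs @ [f]) = (\<Sum>i\<le>length fs. (pderiv ^^ i) f * last_column_cofactor fs i)"
proof -
  let ?n = "length fs"
  define M where "M = (\<lambda>g :: complex poly.
    mat (Suc ?n) (Suc ?n) (\<lambda>(i, j). (pderiv ^^ i) ((fs @ [g]) ! j)))"
  have M: "M g \<in> carrier_mat (Suc ?n) (Suc ?n)" for g
    by (simp add: M_def)
  have "mat_delete (M f) i ?n = mat_delete (M 0) i ?n" for i
    by (rule eq_matI) (auto simp: mat_delete_def M_def nth_append)
  then have cof: "cofactor (M f) i ?n = last_column_cofactor fs i" for i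
    by (simp add: cofactor_def last_column_cofactor_def M_def)
  have "wronskian (fs @ [f]) = det (M f)"
    by (simp add: wronskian_def M_def)
  also have "\<dots> = (\<Sum>i<Suc ?n. M f $$ (i, ?n) * cofactor (M f) i ?n)"
    by (rule laplace_expansion_column[OF M]) simp
  also have "\<dots> = (\<Sum>i\<le>?n. (pderiv ^^ i) f * last_column_cofactor fs i)"
    unfolding cof lessThan_Suc_atMost by (rule sum.cong) (auto simp: M_def)
  finally show ?thesis .
qed

lemma last_column_cofactor_leading: "last_column_cofactor fs (length fs) = wronskian fs"
proof -
  have "mat_delete (mat (Suc (length fs)) (Suc (length fs))
          (\<lambda>(i, j). (pderiv ^^ i) ((fs @ [0]) ! j))) (length fs) (length fs) =
        mat (length fs) (length fs) (\<lambda>(i, j). (pderiv ^^ i) (fs ! j))"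
    by (rule eq_matI) (auto simp: mat_delete_def nth_append)
  then show ?thesis
    by (simp add: last_column_cofactor_def cofactor_def wronskian_def flip: mult_2)
qed

lemma wronskian_snoc_member:
  assumes "f \<in> set fs"
  shows "wronskian (fs @ [f]) = 0"
proof -
  obtain j where j: "j < length fs" "fs ! j = f"
    using assms by (auto simp: in_set_conv_nth)
  show ?thesis unfolding wronskian_def
    by (rule det_identical_columns[of _ "length (fs @ [f])" j "length fs"])
      (use j in \<open>auto intro!: eq_vecI simp: nth_append\<close>)
qed

lemma linear_wronskian_snoc:
  "Vector_Spaces.linear smult smult (\<lambda>f. wronskian (fs @ [f]))"
proof -
  interpret vs: vector_space "smult :: complex \<Rightarrow> complex poly \<Rightarrow> complex poly"
    by (rule vector_space_smult_complex)
  show ?thesis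
    by unfold_locales
      (simp_all add: wronskian_snoc higher_pderiv_add higher_pderiv_smult algebra_simps
        sum.distrib vs.scale_sum_right)
qed

section \<open>Variation of parameters in polynomials\<close>

lemma pderiv_sum: "pderiv (sum f A) = (\<Sum>x\<in>A. pderiv (f x))"
  using higher_pderiv_sum[of 1 f A] by simp

lemma pderiv_surjective:
  fixes p :: "'a :: field_char_0 poly"
  shows "\<exists>q. pderiv q = p"
proof
  have "pderiv (\<Sum>i\<le>degree p. monom (coeff p i / of_nat (Suc i)) (Suc i)) =
        (\<Sum>i\<le>degree p. monom (coeff p i) i)"
    by (simp add: pderiv_sum pderiv_monom del: of_nat_Suc)
  then show "pderiv (\<Sum>i\<le>degree p. monom (coeff p i / of_nat (Suc i)) (Suc i)) = p"
    by (simp add: poly_as_sum_of_monoms)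
qed

text \<open>The \<open>u j\<close> are the last column of the adjugate of the Wronskian matrix, that is, the
  cofactors of its last row. The linear system below says that the Wronskian matrix times its
  adjugate is the determinant times the identity, read off in that column.\<close>

lemma wronskian_last_row_cofactors:
  "\<exists>u. \<forall>i<length fs. (\<Sum>j<length fs. (pderiv ^^ i) (fs ! j) * u j) =
     (if Suc i = length fs then wronskian fs else 0)"
proof -
  let ?n = "length fs"
  define A where "A = mat ?n ?n (\<lambda>(i, j). (pderiv ^^ i) (fs ! j))"
  have A: "A \<in> carrier_mat ?n ?n"
    by (simp add: A_def)
  have dim: "dim_row (adj_mat A) = ?n" "dim_col (adj_mat A) = ?n"
    using adj_mat(1)[OF A] by auto
  define u where "u = (\<lambda>j. adj_mat A $$ (j, ?n - 1))"
  have "(\<Sum>j<?n. (pderiv ^^ i) (fs ! j) * u j) = (if Suc i = ?n then wronskian fs else 0)"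
    if i: "i < ?n" for i
  proof -
    have "(\<Sum>j<?n. (pderiv ^^ i) (fs ! j) * u j) = (A * adj_mat A) $$ (i, ?n - 1)"
      using i dim unfolding times_mat_def scalar_prod_def
      by (auto simp: A_def u_def intro!: sum.cong)
    also have "\<dots> = (det A \<cdot>\<^sub>m 1\<^sub>m ?n) $$ (i, ?n - 1)"
      by (simp only: adj_mat(2)[OF A])
    also have "\<dots> = (if Suc i = ?n then wronskian fs else 0)"
      using i by (auto simp: wronskian_def A_def)
    finally show ?thesis .
  qed
  then show ?thesis by blast
qed

text \<open>In each derivative of \<open>\<Sum>\<^sub>j c\<^sub>j f\<^sub>j\<close> up to order \<open>n - 1\<close> the terms with
  \<open>c\<^sub>j' = u\<^sub>j p\<close> cancel, and at order \<open>n\<close> they contribute \<open>\<eta> p\<close>. Hence \<open>W f\<close>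
  is \<open>\<Sum>\<^sub>j c\<^sub>j W f\<^sub>j = 0\<close> plus \<open>\<eta> p\<close> times the leading coefficient of \<open>W\<close>,
  which is again \<open>\<eta>\<close>.\<close>

lemma wronskian_snoc_eq_square_mult:
  "\<exists>f. wronskian (fs @ [f]) = (wronskian fs)\<^sup>2 * p"
proof (cases "fs = []")
  \<comment> \<open>With no \<open>f\<^sub>j\<close> to combine, \<open>W\<close> is the identity and \<open>\<eta> = 1\<close>.\<close>
  case True
  have "wronskian (fs @ [p]) = (wronskian fs)\<^sup>2 * p"
    unfolding wronskian_snoc using last_column_cofactor_leading[of fs] True
    by (simp add: wronskian_def)
  then show ?thesis ..
next
  case False
  let ?n = "length fs"
  obtain u where u: "\<And>i. i < ?n \<Longrightarrow> (\<Sum>j<?n. (pderiv ^^ i) (fs ! j) * u j) =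
      (if Suc i = ?n then wronskian fs else 0)"
    using wronskian_last_row_cofactors[of fs] by blast
  have "\<forall>j. \<exists>q. pderiv q = u j * p"
    by (simp add: pderiv_surjective)
  then obtain c where c: "\<And>j. pderiv (c j) = u j * p"
    using choice[of "\<lambda>j q. pderiv q = u j * p"] by blast
  define f where "f = (\<Sum>j<?n. c j * fs ! j)"
  have D: "(pderiv ^^ i) f =
      (\<Sum>j<?n. c j * (pderiv ^^ i) (fs ! j)) + (if i = ?n then wronskian fs * p else 0)"
    if "i \<le> ?n" for i
    using that
  proof (induction i)
    case 0
    then show ?case using False by (simp add: f_def)
  next
    case (Suc i)
    have "(pderiv ^^ Suc i) f = pderiv (\<Sum>j<?n. c j * (pderiv ^^ i) (fs ! j))"
      using Suc by simp
    also have "\<dots> = (\<Sum>j<?n. c j * (pderiv ^^ Suc i) (fs ! j)) +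
        (\<Sum>j<?n. (pderiv ^^ i) (fs ! j) * u j) * p"
      by (simp add: pderiv_sum pderiv_mult c sum.distrib sum_distrib_left algebra_simps)
    finally show ?case using Suc.prems by (simp add: u)
  qed
  have "wronskian (fs @ [f]) =
      (\<Sum>i\<le>?n. (\<Sum>j<?n. c j * (pderiv ^^ i) (fs ! j)) * last_column_cofactor fs i) +
      (\<Sum>i\<le>?n. if i = ?n then wronskian fs * p * last_column_cofactor fs i else 0)"
    unfolding wronskian_snoc sum.distrib[symmetric]
    by (rule sum.cong) (auto simp: D algebra_simps)
  also have "(\<Sum>i\<le>?n. (\<Sum>j<?n. c j * (pderiv ^^ i) (fs ! j)) * last_column_cofactor fs i) =
      (\<Sum>j<?n. c j * wronskian (fs @ [fs ! j]))"
    unfolding wronskian_snoc sum_distrib_left sum_distrib_right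
    by (subst sum.swap) (simp add: mult.assoc)
  also have "\<dots> = 0"
    by (simp add: wronskian_snoc_member)
  finally have "wronskian (fs @ [f]) = (wronskian fs)\<^sup>2 * p"
    by (simp add: last_column_cofactor_leading power2_eq_square)
  then show ?thesis ..
qed

section \<open>The Hermite polynomials span\<close>

lemma hermite_0: "hermite 0 = 1"
proof -
  have "poly (hermite 0) = poly 1"
    by (rule ext) (simp add: poly_hermite flip: exp_add)
  then show ?thesis by (simp only: poly_eq_poly_eq_iff)
qed

text \<open>Solved for the derivative, the Rodrigues formula reads
  \<open>(d/dx)\<^sup>n exp (- x\<^sup>2) = (-1)\<^sup>n exp (- x\<^sup>2) H\<^sub>n(x)\<close>;
  the recurrence results from differentiating once more.\<close>

lemma hermite_Suc: "hermite (Suc n) = [:0, 2:] * hermite n - pderiv (hermite n)"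
proof -
  have sq: "(-1::complex) ^ n * ((-1) ^ n * z) = z" for z
    by (simp flip: mult.assoc power_mult_distrib)
  have e: "exp (x\<^sup>2) * (exp (- (x\<^sup>2)) * z) = z" for x z :: complex
    by (simp flip: mult.assoc exp_add)
  have e': "exp (- (x\<^sup>2)) * (exp (x\<^sup>2) * z) = z" for x z :: complex
    by (simp flip: mult.assoc exp_add)
  have D: "(deriv ^^ n) (\<lambda>t. exp (- (t\<^sup>2))) =
      (\<lambda>x. (-1) ^ n * (exp (- (x\<^sup>2)) * poly (hermite n) x))"
    by (rule ext) (simp only: poly_hermite mult.assoc mult.left_commute[of "exp _" "(-1) ^ n"] sq e')
  have "deriv (\<lambda>x. (-1) ^ n * (exp (- (x\<^sup>2)) * poly (hermite n) x)) x =
      (-1) ^ n * (exp (- (x\<^sup>2)) * (poly (pderiv (hermite n)) x - 2 * x * poly (hermite n) x))"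
    for x :: complex
    by (rule DERIV_imp_deriv)
      (auto intro!: derivative_eq_intros poly_DERIV simp: algebra_simps)
  then have "(deriv ^^ Suc n) (\<lambda>t. exp (- (t\<^sup>2))) x =
      (-1) ^ n * (exp (- (x\<^sup>2)) * (poly (pderiv (hermite n)) x - 2 * x * poly (hermite n) x))"
    for x :: complex
    by (simp add: D)
  then have "poly (hermite (Suc n)) x = - (poly (pderiv (hermite n)) x - 2 * x * poly (hermite n) x)"
    for x
    by (simp only: poly_hermite power_Suc mult.assoc mult.left_commute[of "exp _" "(-1) ^ n"]
        sq e mult_minus_left mult_1_left)
  then have "poly (hermite (Suc n)) = poly ([:0, 2:] * hermite n - pderiv (hermite n))"
    by (intro ext) simp
  then show ?thesis by (simp only: poly_eq_poly_eq_iff)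
qed

lemma degree_hermite: "degree (hermite n) = n \<and> hermite n \<noteq> 0"
proof (induction n)
  case 0
  show ?case by (simp add: hermite_0)
next
  case (Suc n)
  have "degree ([:0, 2:] * hermite n) = Suc n"
    using Suc by (subst degree_mult_eq) auto
  moreover have "degree (pderiv (hermite n)) < Suc n"
    using Suc by (simp add: degree_pderiv)
  ultimately have "degree (hermite (Suc n)) = Suc n"
    unfolding hermite_Suc diff_conv_add_uminus by (subst degree_add_eq_left) auto
  then show ?case by auto
qed

text \<open>Any family with one polynomial of each degree spans, by cancelling leading terms.\<close>

lemma span_range_hermite: "module.span smult (range hermite) = UNIV"
proof -
  interpret vs: vector_space "smult :: complex \<Rightarrow> complex poly \<Rightarrow> complex poly"
    by (rule vector_space_smult_complex)
  have "p \<in> vs.span (range hermite)" for p :: "complex poly"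
  proof (induction "degree p" arbitrary: p rule: less_induct)
    case less
    let ?h = "hermite (degree p)"
    define a where "a = lead_coeff p / coeff ?h (degree p)"
    define q where "q = p - smult a ?h"
    have h: "degree ?h = degree p" "coeff ?h (degree p) \<noteq> 0"
      using degree_hermite[of "degree p"] leading_coeff_0_iff[of ?h] by auto
    have "degree q \<le> degree p"
      unfolding q_def using h(1) by (intro degree_diff_le) (auto intro: order.trans[OF degree_smult_le])
    moreover have "coeff q (degree p) = 0"
      using h by (simp add: q_def a_def)
    ultimately have "q = 0 \<or> degree q < degree p"
      by (metis leading_coeff_0_iff le_neq_implies_less)
    then have "q \<in> vs.span (range hermite)"
      using less vs.span_zero by blast
    moreover have "smult a ?h \<in> vs.span (range hermite)"
      by (intro vs.span_scale vs.span_base rangeI)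
    ultimately have "q + smult a ?h \<in> vs.span (range hermite)"
      by (rule vs.span_add)
    then show ?case by (simp add: q_def)
  qed
  then show ?thesis by blast
qed

section \<open>The space \<open>\<U>\<^sub>\<lambda>\<close>\<close>

text \<open>The indices in \<open>K\<^sub>\<lambda>\<close> excluded from the spanning family are those whose
  Wronskian has a repeated entry and vanishes, so the family spans the whole image.\<close>

lemma wronskian_snoc_in_U_part:
  "wronskian (map hermite (rev (partition_ks l)) @ [f]) \<in> U_part l"
proof -
  let ?W = "\<lambda>f. wronskian (map hermite (rev (partition_ks l)) @ [f])"
  interpret vs: vector_space "smult :: complex \<Rightarrow> complex poly \<Rightarrow> complex poly"
    by (rule vector_space_smult_complex)
  interpret W: Vector_Spaces.linear smult smult ?W
    by (rule linear_wronskian_snoc)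
  have "?W (hermite i) \<in> U_part l" for i
  proof (cases "i \<in> K_part l")
    case True
    then have "?W (hermite i) = 0"
      by (intro wronskian_snoc_member) (simp add: K_part_def)
    then show ?thesis by (simp add: U_part_def vs.span_zero)
  next
    case False
    then show ?thesis
      unfolding U_part_def by (intro vs.span_base) (auto simp: H_part_ext_def)
  qed
  then have "vs.span (?W ` range hermite) \<subseteq> U_part l"
    by (intro vs.span_minimal) (auto simp: U_part_def)
  then have "?W ` UNIV \<subseteq> U_part l"
    by (simp only: W.span_image span_range_hermite)
  then show ?thesis by blast
qed

theorem proposition2p6:
  fixes l :: "nat list" and p :: "complex poly"
  assumes "is_partition l"
  shows "(H_part l)\<^sup>2 * p \<in> U_part l"
proof -
  let ?fs = "map hermite (rev (partition_ks l))"
  obtain f where "wronskian (?fs @ [f]) = (wronskian ?fs)\<^sup>2 * p"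
    using wronskian_snoc_eq_square_mult by blast
  then show ?thesis
    using wronskian_snoc_in_U_part[of l f] by (simp add: H_part_def)
qed

end
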